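(* Let $(q_k)_{k\ge 1}$ be a sequence of positive integers with $q_{k+1}\ge q_k(q_k+1)$ for all $k\ge 1$, let $(\xi_k)_{k\ge1}$ be independent random variables with $\mathsf{P}\{\xi_k=0\}=p_{0k}$, $\mathsf{P}\{\xi_k=1\}=p_{1k}$, $p_{0k},p_{1k}\ge 0$, $p_{0k}+p_{1k}=1$, and let $\mu$ be the distribution of $$\xi=\sum_{k=1}^\infty \frac{(-1)^{k+1}\xi_k}{q_k}.$$ Let $\nu^*$ be the uniform distribution on the spectrum of $\mu$ (as defined in the context). Then: 1) $\mu$ is absolutely continuous with respect to $\nu^*$ if and only if $$\sum_{k:\ p_{0k}p_{1k}>0}(1-2p_{0k})^2<+\infty;$$ 2) $\mu$ is singularly continuous with respect to $\nu^*$ if and only if $D:=\prod_{k=1}^\infty\max\{p_{0k},p_{1k}\}=0$ and $$\sum_{k:\ p_{0k}p_{1k}>0}(1-2p_{0k})^2=+\infty.$$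
   Context: The measure $\nu^*$ is the distribution of the random variable $\xi^*=\sum_{k=1}^\infty\frac{(-1)^{k+1}\xi^*_k}{q_k}$, where $\xi^*_k$ are independent random variables taking the values $0$ and $1$ with probabilities $p^*_{0k}$ and $p^*_{1k}$ such that, for $i\in\{0,1\}$: $p^*_{ik}=0$ iff $p_{ik}=0$; $p^*_{ik}=1$ iff $p_{ik}=1$; $p^*_{ik}=\frac12$ iff $p_{ik}\in(0,1)$. "$\mu$ is singularly continuous with respect to $\nu^*$" means that $\mu$ has no atoms and $\mu\perp\nu^*$. *)

theory Defs
  imports "HOL-Probability.Probability"
begin

(* All sequences are indexed by k >= 1; their values at index 0 play no role.
   p i k is the probability of the digit i in {0,1} at position k.
   The values {0,1} are attained almost surely (the two probabilities sum to 1),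
   and bernoulli_digits includes measurability of each xi k through indep_vars. *)

definition digit_probs :: "(nat \<Rightarrow> nat \<Rightarrow> real) \<Rightarrow> bool" where
  "digit_probs p \<longleftrightarrow> (\<forall>k\<ge>1. 0 \<le> p 0 k \<and> 0 \<le> p 1 k \<and> p 0 k + p 1 k = 1)"

definition bernoulli_digits ::
  "'a measure \<Rightarrow> (nat \<Rightarrow> nat \<Rightarrow> real) \<Rightarrow> (nat \<Rightarrow> 'a \<Rightarrow> real) \<Rightarrow> bool" where
  "bernoulli_digits M p \<xi> \<longleftrightarrow>
     prob_space M \<and>
     prob_space.indep_vars M (\<lambda>_. borel) \<xi> {1..} \<and>
     (\<forall>k\<ge>1. \<P>(\<omega> in M. \<xi> k \<omega> = 0) = p 0 k \<and> \<P>(\<omega> in M. \<xi> k \<omega> = 1) = p 1 k)"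

(* suminf starts at 0, hence the shift: the summand with index k is that of position Suc k. *)
definition alternating_series :: "(nat \<Rightarrow> nat) \<Rightarrow> (nat \<Rightarrow> real) \<Rightarrow> real" where
  "alternating_series q x = (\<Sum>k. (-1) ^ (Suc k + 1) * x (Suc k) / real (q (Suc k)))"

definition series_distribution ::
  "'a measure \<Rightarrow> (nat \<Rightarrow> nat) \<Rightarrow> (nat \<Rightarrow> 'a \<Rightarrow> real) \<Rightarrow> real measure" where
  "series_distribution M q \<xi> = distr M borel (\<lambda>\<omega>. alternating_series q (\<lambda>k. \<xi> k \<omega>))"

definition uniform_probs :: "(nat \<Rightarrow> nat \<Rightarrow> real) \<Rightarrow> (nat \<Rightarrow> nat \<Rightarrow> real) \<Rightarrow> bool" where
  "uniform_probs p ps \<longleftrightarrow> (\<forall>k\<ge>1. \<forall>i\<in>{0, 1}.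
     (ps i k = 0 \<longleftrightarrow> p i k = 0) \<and>
     (ps i k = 1 \<longleftrightarrow> p i k = 1) \<and>
     (ps i k = 1/2 \<longleftrightarrow> p i k \<in> {0<..<1}))"

definition mutually_singular :: "'a measure \<Rightarrow> 'a measure \<Rightarrow> bool" where
  "mutually_singular M N \<longleftrightarrow>
     sets M = sets N \<and> (\<exists>A\<in>sets M. emeasure M A = 0 \<and> emeasure N (space N - A) = 0)"

definition singularly_continuous_wrt :: "real measure \<Rightarrow> real measure \<Rightarrow> bool" where
  "singularly_continuous_wrt M N \<longleftrightarrow> (\<forall>x. emeasure M {x} = 0) \<and> mutually_singular M N"

(* The limit of the partial products, so that D = 0 covers products diverging to 0;
   prodinf is unspecified in that case. *)
definition max_product :: "(nat \<Rightarrow> nat \<Rightarrow> real) \<Rightarrow> real" where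
  "max_product p = lim (\<lambda>n. \<Prod>k=1..n. max (p 0 k) (p 1 k))"

lemma max_product_LIMSEQ:
  assumes "digit_probs p"
  shows "(\<lambda>n. \<Prod>k=1..n. max (p 0 k) (p 1 k)) \<longlonglongrightarrow> max_product p"
proof -
  let ?P = "\<lambda>n. \<Prod>k=1..n. max (p 0 k) (p 1 k)"
  have m: "0 \<le> max (p 0 k) (p 1 k) \<and> max (p 0 k) (p 1 k) \<le> 1" if "k \<ge> 1" for k
    using assms that unfolding digit_probs_def by (smt (verit))
  have nonneg: "0 \<le> ?P n" for n
    using m by (intro prod_nonneg) auto
  have "decseq ?P"
    by (intro decseq_SucI) (use m nonneg in \<open>simp add: mult_left_le\<close>)
  then have "convergent ?P"
    using nonneg decseq_convergent[of ?P 0] unfolding convergent_def by metis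
  then show ?thesis
    by (simp add: convergent_LIMSEQ_iff max_product_def)
qed

end

theory Submission
  imports Defs
begin

text \<open>
  The growth of the denominators makes every $1/q_k$ larger than the sum of all later ones. Hence
  the digits can be read off from the value of the series, by a Borel function
  (\<open>digit_alternating_series\<close>), and the question is one about two product measures on
  digit sequences. It is an instance of Kakutani's dichotomy, and the comparison takes place on
  finite words. At a position with $p_{0k} p_{1k} = 0$ both laws have the same deterministic digit;
  at the other positions a law $(p_{0k}, p_{1k})$ is compared with $(1/2, 1/2)$. Put
  $b_k = (1 - 2 p_{0k})^2$ at the latter positions and $b_k = 0$ at the former (\<open>bias\<close>), and
  let $s_n = b_1 + \dots + b_n$. Two estimates for sets $E$ of words of length $n$ decide everything.

  \<^item> Chi-square: one position contributes the factor
    $p_{0k}^2/p^*_{0k} + p_{1k}^2/p^*_{1k} = 1 + b_k$ to the second moment of the density. By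
    Cauchy-Schwarz the square of the $\mu$-mass of $E$ is at most $\exp(s_n)$ times its
    $\nu^*$-mass (\<open>word_mass_chi_square\<close>). If the series converges, the bound is uniform in
    $n$. It passes from words to compact sets of reals because the partial sums approximate the
    value uniformly, and from compact sets to null sets by inner regularity. So
    $\mu \ll \nu^*$.

  \<^item> Hellinger: one position contributes
    $\sqrt{p_{0k} p^*_{0k}} + \sqrt{p_{1k} p^*_{1k}} \le \exp(-b_k/8)$ to the affinity of the
    two laws. So the words to which $\nu^*$ gives at most as much mass as $\mu$ have total $\nu^*$-mass at
    most $\exp(-s_n/8)$ and their complement has $\mu$-mass at most $\exp(-s_n/8)$
    (\<open>word_mass_separation\<close>). If the series diverges, the Borel-Cantelli lemma produces
    a set that separates $\mu$ from $\nu^*$.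

  A probability measure cannot be both absolutely continuous and singular, so both implications are
  equivalences. Finally, the largest atom of $\mu$ has mass $D$: a point determines its digits, and
  the sequence of the most likely digits is taken with probability
  $\prod_k \max \{p_{0k}, p_{1k}\}$ (\<open>no_atoms_iff\<close>).
\<close>

section \<open>Series with rapidly growing denominators\<close>

locale rapid_denominators =
  fixes q :: "nat \<Rightarrow> nat"
  assumes q_pos: "k \<ge> 1 \<Longrightarrow> 0 < q k"
    and q_growth: "k \<ge> 1 \<Longrightarrow> q k * (q k + 1) \<le> q (k + 1)"
begin

lemma q_Suc_ge_double:
  assumes "k \<ge> 1"
  shows "2 * q k \<le> q (Suc k)"
proof -
  have "q k * 2 \<le> q k * (q k + 1)"
    using q_pos[OF assms] by (intro mult_left_mono) auto
  also have "\<dots> \<le> q (Suc k)"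
    using q_growth[OF assms] by simp
  finally show ?thesis by simp
qed

text \<open>
  A ratio of at least 2 throughout would only give that a tail is at most the preceding term.
  The ratio 3 from the second denominator on makes the inequality strict.
\<close>

lemma q_Suc_ge_triple:
  assumes "k \<ge> 2"
  shows "3 * q k \<le> q (Suc k)"
proof -
  obtain j where j: "k = Suc j" "j \<ge> 1" using assms by (cases k) auto
  have "2 \<le> q k"
    using q_Suc_ge_double[OF j(2)] q_pos[OF j(2)] j by simp
  then have "q k * 3 \<le> q k * (q k + 1)"
    by (intro mult_left_mono) auto
  also have "\<dots> \<le> q (Suc k)"
    using q_growth[of k] assms by simp
  finally show ?thesis by simp
qed

lemma q_ge_power2: "2 ^ j \<le> q (Suc j)"
proof (induction j)
  case 0
  then show ?case using q_pos[of 1] by simp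
next
  case (Suc j)
  then show ?case using q_Suc_ge_double[of "Suc j"] by simp
qed

lemma q_ge_power3: "3 ^ j * q (Suc (Suc k)) \<le> q (Suc (Suc k) + j)"
proof (induction j)
  case (Suc j)
  then show ?case using q_Suc_ge_triple[of "Suc (Suc k) + j"] by simp
qed simp

lemma inverse_q_le_half_power: "1 / real (q (Suc j)) \<le> (1/2) ^ j"
proof -
  have "real (2 ^ j) \<le> real (q (Suc j))"
    using q_ge_power2 of_nat_le_iff by blast
  then have "1 / real (q (Suc j)) \<le> 1 / 2 ^ j"
    by (intro divide_left_mono) (auto simp: q_pos)
  then show ?thesis
    by (simp add: power_one_over)
qed

lemma summable_inverse_q: "summable (\<lambda>j. 1 / real (q (Suc j)))"
  by (rule summable_comparison_test'[of "\<lambda>j. (1/2) ^ j" 0])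
     (use inverse_q_le_half_power in \<open>auto simp: summable_geometric\<close>)

text \<open>
  With ratio at least 2 in the first step and at least 3 afterwards, the tail is at most
  $\frac12 (1 + \frac13 + \frac19 + \dots) = \frac34$ of the term before it.
\<close>

lemma inverse_q_tail_less: "(\<Sum>j. 1 / real (q (Suc (j + Suc k)))) < 1 / real (q (Suc k))"
proof -
  have pos: "0 < real (q (Suc k))" "0 < real (q (Suc (Suc k)))"
    using q_pos[of "Suc k"] q_pos[of "Suc (Suc k)"] by simp_all
  have geo: "summable (\<lambda>j. 1 / real (q (Suc (Suc k))) * (1/3) ^ j)"
    by (intro summable_mult summable_geometric) simp
  have "(\<Sum>j. 1 / real (q (Suc (j + Suc k)))) \<le> (\<Sum>j. 1 / real (q (Suc (Suc k))) * (1/3) ^ j)"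
  proof (rule suminf_le[OF _ _ geo])
    show "summable (\<lambda>j. 1 / real (q (Suc (j + Suc k))))"
      using summable_inverse_q by (subst summable_iff_shift[of "\<lambda>j. 1 / real (q (Suc j))" "Suc k"])
    fix j
    have "real (3 ^ j * q (Suc (Suc k))) \<le> real (q (Suc (Suc k) + j))"
      using q_ge_power3 of_nat_le_iff by blast
    moreover have "0 < real (q (Suc (Suc k) + j))"
      using q_pos[of "Suc (Suc k) + j"] by simp
    ultimately show "1 / real (q (Suc (j + Suc k))) \<le> 1 / real (q (Suc (Suc k))) * (1/3) ^ j"
      using pos by (simp add: field_simps power_one_over add.commute)
  qed
  also have "\<dots> = 1 / real (q (Suc (Suc k))) * (3 / 2)"
    by (subst suminf_mult) (simp_all add: summable_geometric suminf_geometric)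
  also have "\<dots> < 1 / real (q (Suc k))"
  proof -
    have "real (2 * q (Suc k)) \<le> real (q (Suc (Suc k)))"
      using q_Suc_ge_double[of "Suc k"] of_nat_le_iff by force
    then show ?thesis
      using pos by (simp add: field_simps)
  qed
  finally show ?thesis .
qed

lemma summable_signed_tail:
  assumes "\<And>j. \<bar>x j\<bar> \<le> 1"
  shows "summable (\<lambda>j. \<bar>(-1) ^ (Suc (j + k) + 1) * x j / real (q (Suc (j + k)))\<bar>)"
proof (rule summable_comparison_test'[of "\<lambda>j. 1 / real (q (Suc (j + k)))" 0])
  show "summable (\<lambda>j. 1 / real (q (Suc (j + k))))"
    using summable_inverse_q by (subst summable_iff_shift[of "\<lambda>j. 1 / real (q (Suc j))" k])
qed (use assms in \<open>auto simp: abs_mult power_abs intro!: divide_right_mono\<close>)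

lemma abs_signed_tail_le:
  assumes "\<And>j. \<bar>x j\<bar> \<le> c"
  shows "\<bar>\<Sum>j. (-1) ^ (Suc (j + k) + 1) * x j / real (q (Suc (j + k)))\<bar>
           \<le> c * (\<Sum>j. 1 / real (q (Suc (j + k))))"
proof -
  let ?t = "\<lambda>j. (-1) ^ (Suc (j + k) + 1) * x j / real (q (Suc (j + k)))"
  have r: "summable (\<lambda>j. 1 / real (q (Suc (j + k))))"
    using summable_inverse_q by (subst summable_iff_shift[of "\<lambda>j. 1 / real (q (Suc j))" k])
  have le: "\<bar>?t j\<bar> \<le> c * (1 / real (q (Suc (j + k))))" for j
    using assms[of j] by (auto simp: abs_mult power_abs intro!: divide_right_mono)
  have "summable (\<lambda>j. \<bar>?t j\<bar>)"
    by (rule summable_comparison_test'[OF summable_mult[OF r, of c], of 0]) (use le in auto)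
  then have "\<bar>\<Sum>j. ?t j\<bar> \<le> (\<Sum>j. \<bar>?t j\<bar>)"
    by (rule summable_rabs)
  also have "\<dots> \<le> (\<Sum>j. c * (1 / real (q (Suc (j + k)))))"
    by (rule suminf_le[OF le \<open>summable (\<lambda>j. \<bar>?t j\<bar>)\<close> summable_mult[OF r]])
  also have "\<dots> = c * (\<Sum>j. 1 / real (q (Suc (j + k))))"
    by (rule suminf_mult[OF r])
  finally show ?thesis .
qed

text \<open>
  The error is uniform over all digit sequences; this is what carries estimates for finite words
  over to compact sets of values.
\<close>

lemma alternating_series_approx:
  assumes "\<And>k. k \<ge> 1 \<Longrightarrow> \<bar>x k\<bar> \<le> 1"
  shows "\<bar>alternating_series q x - (\<Sum>j<n. (-1) ^ (Suc j + 1) * x (Suc j) / real (q (Suc j)))\<bar>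
           \<le> 2 * (1/2) ^ n"
proof -
  let ?t = "\<lambda>j. (-1) ^ (Suc j + 1) * x (Suc j) / real (q (Suc j))"
  have "summable (\<lambda>j. \<bar>?t j\<bar>)"
    using summable_signed_tail[of "\<lambda>j. x (Suc j)" 0] assms by simp
  then have "summable ?t"
    by (rule summable_rabs_cancel)
  then have "alternating_series q x - (\<Sum>j<n. ?t j) = (\<Sum>j. ?t (j + n))"
    unfolding alternating_series_def by (subst suminf_minus_initial_segment) simp_all
  also have "\<bar>\<dots>\<bar> \<le> 1 * (\<Sum>j. 1 / real (q (Suc (j + n))))"
    using assms by (intro abs_signed_tail_le[of "\<lambda>j. x (Suc (j + n))"]) auto
  also have "\<dots> \<le> (\<Sum>j. (1/2) ^ (j + n))"
    using summable_inverse_q inverse_q_le_half_power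
    by (simp add: suminf_le summable_iff_shift[of "\<lambda>j. 1 / real (q (Suc j))"]
          summable_iff_shift[of "\<lambda>j. (1/2::real) ^ j"] summable_geometric)
  also have "\<dots> = 2 * (1/2) ^ n"
    by (simp add: power_add suminf_mult2[symmetric] suminf_geometric summable_geometric)
  finally show ?thesis .
qed

end

section \<open>Reading the digits off the value\<close>

text \<open>
  Subtracting $1/2$ from every digit makes all terms nonzero and equal in modulus to half of
  $1/q_k$, so that each term dominates the tail after it and the sign of a tail is the sign of its
  first term.
\<close>

definition centered_term :: "(nat \<Rightarrow> nat) \<Rightarrow> (nat \<Rightarrow> real) \<Rightarrow> nat \<Rightarrow> real" where
  "centered_term q x j = (-1) ^ (Suc j + 1) * (x (Suc j) - 1/2) / real (q (Suc j))"

text \<open>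
  For the value $y$ of a digit sequence this is the centred tail that remains after the first $k$
  terms: its sign reveals the next centred term, which has modulus $1 / (2 q_{k+1})$ and is
  subtracted.
\<close>

primrec remainder :: "(nat \<Rightarrow> nat) \<Rightarrow> nat \<Rightarrow> real \<Rightarrow> real" where
  "remainder q 0 y = y - alternating_series q (\<lambda>_. 1/2)"
| "remainder q (Suc k) y = remainder q k y - sgn (remainder q k y) / (2 * real (q (Suc k)))"

text \<open>
  The digit at position $k \ge 1$ belongs to the term with index $k - 1$ of the series, whose sign
  is $(-1)^{k+1}$; hence the shift.
\<close>

definition digit :: "(nat \<Rightarrow> nat) \<Rightarrow> nat \<Rightarrow> real \<Rightarrow> nat" where
  "digit q k y = (if (-1) ^ (k + 1) * remainder q (k - 1) y > 0 then 1 else 0)"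

lemma remainder_measurable [measurable]: "remainder q k \<in> borel_measurable borel"
  by (induction k) simp_all

lemma digit_measurable [measurable]: "digit q k \<in> measurable borel (count_space UNIV)"
  unfolding digit_def by measurable

context rapid_denominators
begin

text \<open>
  The tail after the first term has modulus less than $1 / (2 q_{k+1})$, the modulus of the first
  term. So the first term decides the sign.
\<close>

lemma centered_tail_step:
  assumes x: "\<And>k. k \<ge> 1 \<Longrightarrow> x k \<in> {0, 1 :: real}"
  shows sgn_centered_tail:
      "sgn (\<Sum>j. centered_term q x (j + k)) = (-1) ^ k * (2 * x (Suc k) - 1)"
    and centered_tail_Suc:
      "(\<Sum>j. centered_term q x (j + Suc k)) = (\<Sum>j. centered_term q x (j + k)) - centered_term q x k"
proof -
  let ?t = "centered_term q x"
  have half: "\<bar>x (Suc j) - 1/2\<bar> = 1/2" for j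
    using x[of "Suc j"] by auto
  have "summable (\<lambda>j. \<bar>?t j\<bar>)"
    unfolding centered_term_def using summable_signed_tail[of "\<lambda>j. x (Suc j) - 1/2" 0] half by simp
  then have summ: "summable ?t"
    by (rule summable_rabs_cancel)
  show step: "(\<Sum>j. ?t (j + Suc k)) = (\<Sum>j. ?t (j + k)) - ?t k"
    using suminf_split_head[of "\<lambda>j. ?t (j + k)"] summ by (simp add: summable_iff_shift)
  have "\<bar>\<Sum>j. ?t (j + Suc k)\<bar> \<le> 1/2 * (\<Sum>j. 1 / real (q (Suc (j + Suc k))))"
    unfolding centered_term_def using half by (intro abs_signed_tail_le[of "\<lambda>j. x (Suc (j + Suc k)) - 1/2"]) simp
  also have "\<dots> < 1/2 * (1 / real (q (Suc k)))"
    using inverse_q_tail_less by simp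
  finally have small: "\<bar>\<Sum>j. ?t (j + Suc k)\<bar> < 1 / (2 * real (q (Suc k)))" by simp
  have tk: "?t k = (-1) ^ k * (2 * x (Suc k) - 1) * (1 / (2 * real (q (Suc k))))"
    using q_pos[of "Suc k"] by (simp add: centered_term_def field_simps)
  have pm: "(-1) ^ k * (2 * x (Suc k) - 1) = 1 \<or> (-1) ^ k * (2 * x (Suc k) - 1) = -1"
    using x[of "Suc k"] by (cases "even k") auto
  show "sgn (\<Sum>j. ?t (j + k)) = (-1) ^ k * (2 * x (Suc k) - 1)"
    using pm
  proof
    assume e: "(-1) ^ k * (2 * x (Suc k) - 1) = 1"
    then show ?thesis using small step tk unfolding e by simp
  next
    assume e: "(-1) ^ k * (2 * x (Suc k) - 1) = -1"
    then show ?thesis using small step tk unfolding e by simp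
  qed
qed

lemma remainder_alternating_series:
  assumes x: "\<And>k. k \<ge> 1 \<Longrightarrow> x k \<in> {0, 1 :: real}"
  shows "remainder q k (alternating_series q x) =
           (\<Sum>j. centered_term q x (j + k))"
proof (induction k)
  case 0
  have s: "summable (\<lambda>j. (-1) ^ (Suc j + 1) * y (Suc j) / real (q (Suc j)))"
    if "\<And>j. \<bar>y (Suc j)\<bar> \<le> 1" for y :: "nat \<Rightarrow> real"
    using summable_rabs_cancel[OF summable_signed_tail[of "\<lambda>j. y (Suc j)" 0]] that by simp
  have "\<bar>x (Suc j)\<bar> \<le> 1" for j using x[of "Suc j"] by auto
  then show ?case
    using suminf_diff[OF s[of x] s[of "\<lambda>_. 1/2"]]
    by (simp add: alternating_series_def centered_term_def algebra_simps diff_divide_distrib)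
next
  case (Suc k)
  have "centered_term q x k =
          (-1) ^ k * (2 * x (Suc k) - 1) / (2 * real (q (Suc k)))"
    by (simp add: centered_term_def field_simps)
  then show ?case
    using Suc sgn_centered_tail[of x k] centered_tail_Suc[of x k] x by simp
qed

lemma digit_alternating_series:
  assumes x: "\<And>k. k \<ge> 1 \<Longrightarrow> x k \<in> {0, 1 :: real}" and "k \<ge> 1"
  shows "real (digit q k (alternating_series q x)) = x k"
proof -
  obtain j where k: "k = Suc j" using \<open>k \<ge> 1\<close> by (cases k) auto
  have "sgn (remainder q j (alternating_series q x)) = (-1) ^ j * (2 * x k - 1)"
    using remainder_alternating_series[of x j] sgn_centered_tail[of x j] x k by simp
  then have "sgn ((-1) ^ (k + 1) * remainder q j (alternating_series q x)) = 2 * x k - 1"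
    by (simp add: sgn_mult k)
  then show ?thesis
    using x[OF \<open>k \<ge> 1\<close>] by (auto simp: digit_def k sgn_if split: if_splits)
qed

end

section \<open>Comparing the masses of finite words\<close>

definition words :: "nat \<Rightarrow> (nat \<Rightarrow> nat) set" where
  "words n = (\<Pi>\<^sub>E k\<in>{1..n}. {0, 1})"

definition word_mass :: "(nat \<Rightarrow> nat \<Rightarrow> real) \<Rightarrow> nat \<Rightarrow> (nat \<Rightarrow> nat) set \<Rightarrow> real" where
  "word_mass p n E = (\<Sum>x\<in>E. \<Prod>k=1..n. p (x k) k)"

definition bias :: "(nat \<Rightarrow> nat \<Rightarrow> real) \<Rightarrow> nat \<Rightarrow> real" where
  "bias p k = (if k \<ge> 1 \<and> p 0 k * p 1 k > 0 then (1 - 2 * p 0 k)\<^sup>2 else 0)"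

lemma bias_nonneg: "0 \<le> bias p k"
  by (simp add: bias_def)

lemma finite_words [simp]: "finite (words n)"
  unfolding words_def by (intro finite_PiE) auto

lemma words_digit: "x \<in> words n \<Longrightarrow> k \<in> {1..n} \<Longrightarrow> x k \<in> {0, 1}"
  by (auto simp: words_def)

lemma sum_words_prod: "(\<Sum>x\<in>words n. \<Prod>k=1..n. f (x k) k) = (\<Prod>k=1..n. f 0 k + (f 1 k :: real))"
proof -
  have "(\<Prod>k=1..n. \<Sum>i\<in>{0, 1::nat}. f i k) = (\<Sum>x\<in>words n. \<Prod>k=1..n. f (x k) k)"
    unfolding words_def by (rule prod_sum_PiE) auto
  then show ?thesis by simp
qed

text \<open>
  At each position either both laws give the same digit with certainty, or the reference law is
  the fair one.
\<close>

lemma uniform_probs_cases: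
  assumes "digit_probs p" "uniform_probs p ps" "k \<ge> 1"
  obtains "p 0 k = 0" "p 1 k = 1" "ps 0 k = 0" "ps 1 k = 1" "bias p k = 0"
  | "p 0 k = 1" "p 1 k = 0" "ps 0 k = 1" "ps 1 k = 0" "bias p k = 0"
  | "0 < p 0 k" "0 < p 1 k" "p 1 k = 1 - p 0 k" "ps 0 k = 1/2" "ps 1 k = 1/2"
    "bias p k = (1 - 2 * p 0 k)\<^sup>2"
proof -
  have p: "0 \<le> p 0 k" "0 \<le> p 1 k" "p 1 k = 1 - p 0 k"
    using assms(1,3) unfolding digit_probs_def by (smt (verit))+
  have ps: "(ps i k = 0 \<longleftrightarrow> p i k = 0) \<and> (ps i k = 1 \<longleftrightarrow> p i k = 1) \<and>
      (ps i k = 1/2 \<longleftrightarrow> p i k \<in> {0<..<1})" if "i \<in> {0, 1}" for i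
    using assms(2,3) that unfolding uniform_probs_def by blast
  consider "p 0 k = 0" | "p 0 k = 1" | "0 < p 0 k" "0 < p 1 k"
    using p by linarith
  then show ?thesis
  proof cases
    case 1
    then show ?thesis using that(1) p ps[of 0] ps[of 1] by (simp add: bias_def)
  next
    case 2
    then show ?thesis using that(2) p ps[of 0] ps[of 1] by (simp add: bias_def)
  next
    case 3
    then show ?thesis using that(3) p ps[of 0] ps[of 1] \<open>k \<ge> 1\<close> by (simp add: bias_def)
  qed
qed

lemma uniform_probs_digit_probs:
  assumes "digit_probs p" "uniform_probs p ps"
  shows "digit_probs ps"
  unfolding digit_probs_def
proof (intro allI impI)
  fix k :: nat assume "k \<ge> 1"
  then show "0 \<le> ps 0 k \<and> 0 \<le> ps 1 k \<and> ps 0 k + ps 1 k = 1"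
    by (rule uniform_probs_cases[OF assms]) auto
qed

lemma chi_square_factor:
  assumes "digit_probs p" "uniform_probs p ps" "k \<ge> 1"
  shows "(p 0 k)\<^sup>2 / ps 0 k + (p 1 k)\<^sup>2 / ps 1 k = 1 + bias p k"
  using assms
proof (cases rule: uniform_probs_cases)
  case 3
  show ?thesis
    unfolding 3 by (simp add: power2_eq_square algebra_simps)
qed auto

text \<open>
  Let $a = p_{0k}$ and $u = (1 - 2a)^2$. The square of the left side is
  $\frac12 (1 + 2 \sqrt{a (1 - a)}) = \frac12 (1 + \sqrt{1 - u}) \le 1 - u/4 \le e^{-u/4}$.
\<close>

lemma hellinger_factor:
  assumes "digit_probs p" "uniform_probs p ps" "k \<ge> 1"
  shows "sqrt (p 0 k * ps 0 k) + sqrt (p 1 k * ps 1 k) \<le> exp (- bias p k / 8)"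
  using assms
proof (cases rule: uniform_probs_cases)
  case 3
  define a where "a = p 0 k"
  define u where "u = (1 - 2 * a)\<^sup>2"
  have a: "0 < a" "a < 1" using 3 by (auto simp: a_def)
  have "2 * sqrt (a * (1 - a)) = sqrt (1 - u)"
  proof -
    have "1 - u = 2\<^sup>2 * (a * (1 - a))" by (simp add: u_def power2_eq_square algebra_simps)
    then show ?thesis by (simp add: real_sqrt_mult)
  qed
  also have "\<dots> \<le> 1 - u / 2"
  proof (rule real_le_lsqrt)
    have "u = 1 - 4 * (a * (1 - a))" by (simp add: u_def power2_eq_square algebra_simps)
    moreover have "0 < a * (1 - a)" using a by simp
    ultimately show "0 \<le> 1 - u / 2" by linarith
    show "1 - u \<le> (1 - u / 2)\<^sup>2" by (simp add: power2_eq_square algebra_simps)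
  qed
  finally have s: "2 * sqrt (a * (1 - a)) \<le> 1 - u / 2" .
  have "(sqrt (a * (1/2)) + sqrt ((1 - a) * (1/2)))\<^sup>2 = (1 + 2 * sqrt (a * (1 - a))) / 2"
    using a by (simp add: power2_sum real_sqrt_mult power_mult_distrib real_sqrt_divide power_divide add_divide_distrib)
      (simp add: field_simps)
  also have "\<dots> \<le> 1 + (- u / 4)" using s by simp
  also have "\<dots> \<le> exp (- u / 4)" by (rule exp_ge_add_one_self)
  also have "\<dots> = (exp (- u / 8))\<^sup>2" by (simp flip: exp_double)
  finally have "sqrt (a * (1/2)) + sqrt ((1 - a) * (1/2)) \<le> exp (- u / 8)"
    by (rule power2_le_imp_le) simp
  then show ?thesis unfolding 3 by (simp add: a_def u_def)
qed auto

lemma digit_probs_nonneg: "digit_probs p \<Longrightarrow> k \<ge> 1 \<Longrightarrow> i \<in> {0, 1} \<Longrightarrow> 0 \<le> p i k"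
  unfolding digit_probs_def by auto

lemma prod_word_nonneg:
  assumes "digit_probs p" "x \<in> words n"
  shows "0 \<le> (\<Prod>k=1..n. p (x k) k)"
proof (intro prod_nonneg ballI)
  fix k assume "k \<in> {1..n}"
  then show "0 \<le> p (x k) k"
    using digit_probs_nonneg[OF assms(1), of k "x k"] words_digit[OF assms(2)] by auto
qed

lemma word_mass_nonneg:
  assumes "digit_probs p" "E \<subseteq> words n"
  shows "0 \<le> word_mass p n E"
  unfolding word_mass_def
  by (intro sum_nonneg prod_word_nonneg[OF assms(1)]) (use assms(2) in blast)

text \<open>
  Write $f$ and $g$ for the two masses of a word. Cauchy-Schwarz for
  $f = (f / \sqrt g) \cdot \sqrt g$ leaves the sum of $f^2 / g$ over all words, which factors into a
  product over the positions.
\<close>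

lemma word_mass_chi_square:
  assumes p: "digit_probs p" and ps: "uniform_probs p ps" and E: "E \<subseteq> words n"
  shows "(word_mass p n E)\<^sup>2 \<le> exp (\<Sum>k=1..n. bias p k) * word_mass ps n E"
proof -
  note ps' = uniform_probs_digit_probs[OF p ps]
  let ?f = "\<lambda>x. \<Prod>k=1..n. p (x k) k" and ?g = "\<lambda>x. \<Prod>k=1..n. ps (x k) k"
  have g0: "0 \<le> ?g x" if "x \<in> words n" for x
    by (rule prod_word_nonneg[OF ps' that])
  \<comment> \<open>where the reference mass vanishes, so does the other one, and the quotient is 0\<close>
  have split: "?f x = ?f x / sqrt (?g x) * sqrt (?g x)" if "x \<in> words n" for x
  proof (cases "?g x = 0")
    case True
    then obtain k where k: "k \<in> {1..n}" "ps (x k) k = 0" by auto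
    have "p (x k) k = 0"
      by (rule uniform_probs_cases[OF p ps, of k]) (use k words_digit[OF that k(1)] in auto)
    then have "?f x = 0"
      using k(1) by (intro prod_zero) auto
    then show ?thesis by simp
  qed (use g0[OF that] in simp)
  have "(word_mass p n E)\<^sup>2 = (\<Sum>x\<in>E. ?f x / sqrt (?g x) * sqrt (?g x))\<^sup>2"
    unfolding word_mass_def 
    by (intro arg_cong[of _ _ power2] sum.cong refl split) (use E in blast)
  also have "\<dots> \<le> (\<Sum>x\<in>E. (?f x / sqrt (?g x))\<^sup>2) * (\<Sum>x\<in>E. (sqrt (?g x))\<^sup>2)"
    by (rule Cauchy_Schwarz_ineq_sum)
  also have "(\<Sum>x\<in>E. (sqrt (?g x))\<^sup>2) = word_mass ps n E"
    unfolding word_mass_def using g0 E by (intro sum.cong) auto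
  also have "(\<Sum>x\<in>E. (?f x / sqrt (?g x))\<^sup>2) \<le> (\<Sum>x\<in>words n. (?f x / sqrt (?g x))\<^sup>2)"
    by (intro sum_mono2) (use E in auto)
  also have "\<dots> = (\<Sum>x\<in>words n. \<Prod>k=1..n. (p (x k) k)\<^sup>2 / ps (x k) k)"
    using g0 by (intro sum.cong) (simp_all add: power_divide prod_dividef prod_power_distrib)
  also have "\<dots> = (\<Prod>k=1..n. 1 + bias p k)"
    unfolding sum_words_prod[of "\<lambda>i k. (p i k)\<^sup>2 / ps i k"]
    using chi_square_factor[OF p ps] by (intro prod.cong) auto
  also have "\<dots> \<le> (\<Prod>k=1..n. exp (bias p k))"
    by (intro prod_mono) (auto simp: bias_nonneg add_nonneg_nonneg)
  also have "\<dots> = exp (\<Sum>k=1..n. bias p k)"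
    by (simp add: exp_sum)
  finally show ?thesis
    using word_mass_nonneg[OF ps' E] by (simp add: mult_right_mono)
qed

text \<open>
  The separating set is the one of the likelihood ratio test. On either side of it the mass in
  question is the smaller of the two masses, which is at most their geometric mean; the sum of the
  geometric means over all words is the Hellinger affinity and factors over the positions.
\<close>

lemma word_mass_separation:
  assumes p: "digit_probs p" and ps: "uniform_probs p ps"
  obtains E where "E \<subseteq> words n"
    "word_mass ps n E \<le> exp (- (\<Sum>k=1..n. bias p k) / 8)"
    "word_mass p n (words n - E) \<le> exp (- (\<Sum>k=1..n. bias p k) / 8)"
proof
  note ps' = uniform_probs_digit_probs[OF p ps]
  let ?f = "\<lambda>x. \<Prod>k=1..n. p (x k) k" and ?g = "\<lambda>x. \<Prod>k=1..n. ps (x k) k"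
  define E where "E = {x \<in> words n. ?g x \<le> ?f x}"
  note nonneg = prod_word_nonneg[OF p] prod_word_nonneg[OF ps']
  have sqrt_prod: "sqrt (\<Prod>k\<in>A. h k) = (\<Prod>k\<in>A. sqrt (h k))" for A and h :: "nat \<Rightarrow> real"
    by (induction A rule: infinite_finite_induct) (simp_all add: real_sqrt_mult)
  have min_le: "min a b \<le> sqrt (a * b)" if "0 \<le> a" "0 \<le> b" for a b :: real
    using that by (intro real_le_rsqrt) (auto simp: power2_eq_square min_def intro: mult_left_mono mult_right_mono)
  have bound: "(\<Sum>x\<in>F. min (?f x) (?g x)) \<le> exp (- (\<Sum>k=1..n. bias p k) / 8)" if "F \<subseteq> words n" for F
  proof -
    have "(\<Sum>x\<in>F. min (?f x) (?g x)) \<le> (\<Sum>x\<in>F. sqrt (?f x * ?g x))"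
      using that nonneg by (intro sum_mono min_le) auto
    also have "\<dots> \<le> (\<Sum>x\<in>words n. sqrt (?f x * ?g x))"
      using that nonneg by (intro sum_mono2) auto
    also have "\<dots> = (\<Sum>x\<in>words n. \<Prod>k=1..n. sqrt (p (x k) k * ps (x k) k))"
      by (simp add: sqrt_prod flip: prod.distrib)
    also have "\<dots> = (\<Prod>k=1..n. sqrt (p 0 k * ps 0 k) + sqrt (p 1 k * ps 1 k))"
      by (rule sum_words_prod[of "\<lambda>i k. sqrt (p i k * ps i k)"])
    also have "\<dots> \<le> (\<Prod>k=1..n. exp (- bias p k / 8))"
      using hellinger_factor[OF p ps] digit_probs_nonneg[OF p] digit_probs_nonneg[OF ps']
      by (intro prod_mono) (auto intro!: add_nonneg_nonneg)
    also have "\<dots> = exp (- (\<Sum>k=1..n. bias p k) / 8)"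
      by (simp add: exp_sum[symmetric] sum_divide_distrib sum_negf)
    finally show ?thesis .
  qed
  show "E \<subseteq> words n" by (auto simp: E_def)
  have "word_mass ps n E = (\<Sum>x\<in>E. min (?f x) (?g x))"
    unfolding word_mass_def by (intro sum.cong) (auto simp: E_def)
  then show "word_mass ps n E \<le> exp (- (\<Sum>k=1..n. bias p k) / 8)"
    using bound[OF \<open>E \<subseteq> words n\<close>] by simp
  have "word_mass p n (words n - E) = (\<Sum>x\<in>words n - E. min (?f x) (?g x))"
    unfolding word_mass_def by (intro sum.cong) (auto simp: E_def)
  then show "word_mass p n (words n - E) \<le> exp (- (\<Sum>k=1..n. bias p k) / 8)"
    using bound[of "words n - E"] by auto
qed

section \<open>The random digits and the law of the series\<close>

locale bernoulli_model =
  fixes M :: "'a measure" and p :: "nat \<Rightarrow> nat \<Rightarrow> real" and \<xi> :: "nat \<Rightarrow> 'a \<Rightarrow> real"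
  assumes bernoulli: "bernoulli_digits M p \<xi>"
    and probs: "digit_probs p"

sublocale bernoulli_model \<subseteq> prob_space M
  using bernoulli by (simp add: bernoulli_digits_def)

context bernoulli_model
begin

lemma xi_indep: "indep_vars (\<lambda>_. borel) \<xi> {1..}"
  and prob_xi: "k \<ge> 1 \<Longrightarrow> i \<in> {0, 1} \<Longrightarrow> prob {\<omega>\<in>space M. \<xi> k \<omega> = real i} = p i k"
  using bernoulli by (auto simp: bernoulli_digits_def)

lemma xi_measurable: "k \<ge> 1 \<Longrightarrow> random_variable borel (\<xi> k)"
  using xi_indep by (auto simp: indep_vars_def)

lemma xi_event: "k \<ge> 1 \<Longrightarrow> {\<omega>\<in>space M. \<xi> k \<omega> = c} \<in> events"
  using xi_measurable[of k] by measurable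

lemma AE_xi: "AE \<omega> in M. \<forall>k\<ge>1. \<xi> k \<omega> \<in> {0, 1}"
proof -
  have "AE \<omega> in M. k \<ge> 1 \<longrightarrow> \<xi> k \<omega> \<in> {0, 1}" for k
  proof (cases "k \<ge> 1")
    case True
    let ?A = "\<lambda>i. {\<omega>\<in>space M. \<xi> k \<omega> = real i}"
    have "prob (?A 0 \<union> ?A 1) = prob (?A 0) + prob (?A 1)"
      by (rule finite_measure_Union) (use xi_event[OF True] in auto)
    also have "\<dots> = 1"
      using prob_xi[OF True, of 0] prob_xi[OF True, of 1] probs True
      by (simp add: digit_probs_def)
    finally have "AE \<omega> in M. \<omega> \<in> ?A 0 \<union> ?A 1"
      by (subst (asm) prob_eq_1) (use xi_event[OF True] in auto)
    then show ?thesis by eventually_elim auto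
  qed simp
  then show ?thesis by (simp add: AE_all_countable)
qed

definition cylinder :: "nat \<Rightarrow> (nat \<Rightarrow> nat) \<Rightarrow> 'a set" where
  "cylinder n x = {\<omega>\<in>space M. \<forall>k\<in>{1..n}. \<xi> k \<omega> = real (x k)}"

lemma cylinder_event [measurable]: "cylinder n x \<in> events"
proof -
  have "cylinder n x = space M \<inter> (\<Inter>k\<in>{1..n}. {\<omega>\<in>space M. \<xi> k \<omega> = real (x k)})"
    by (auto simp: cylinder_def)
  also have "\<dots> \<in> events"
    using xi_event by (cases "n = 0") (auto intro!: sets.Int sets.finite_INT)
  finally show ?thesis .
qed

lemma prob_cylinder:
  assumes "\<And>k. k \<in> {1..n} \<Longrightarrow> x k \<in> {0, 1}"
  shows "prob (cylinder n x) = (\<Prod>k=1..n. p (x k) k)"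
proof (cases "n = 0")
  case True
  then show ?thesis by (simp add: cylinder_def prob_space)
next
  case False
  let ?A = "\<lambda>k. \<xi> k -` {real (x k)} \<inter> space M"
  have "cylinder n x = (\<Inter>k\<in>{1..n}. ?A k)"
    using False by (fastforce simp: cylinder_def)
  then have "prob (cylinder n x) = (\<Prod>k=1..n. prob (?A k))"
    using indep_varsD[OF xi_indep, of "{1..n}" "\<lambda>k. {real (x k)}"] False by simp
  also have "\<dots> = (\<Prod>k=1..n. p (x k) k)"
  proof (rule prod.cong)
    fix k assume k: "k \<in> {1..n}"
    have "?A k = {\<omega>\<in>space M. \<xi> k \<omega> = real (x k)}" by auto
    then show "prob (?A k) = p (x k) k"
      using prob_xi[of k "x k"] assms[OF k] k by simp
  qed simp
  finally show ?thesis .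
qed

lemma disjoint_cylinders: "disjoint_family_on (cylinder n) (words n)"
proof (unfold disjoint_family_on_def, intro ballI impI)
  fix x y assume xy: "x \<in> words n" "y \<in> words n" "x \<noteq> y"
  then obtain k where "k \<in> {1..n}" "x k \<noteq> y k"
    unfolding words_def by (meson PiE_ext)
  then show "cylinder n x \<inter> cylinder n y = {}"
    by (force simp: cylinder_def)
qed

lemma prob_cylinder_union:
  assumes "E \<subseteq> words n"
  shows "prob (\<Union>x\<in>E. cylinder n x) = word_mass p n E"
proof -
  have "prob (\<Union>x\<in>E. cylinder n x) = (\<Sum>x\<in>E. prob (cylinder n x))"
    using assms disjoint_cylinders finite_subset[OF assms]
    by (intro finite_measure_finite_Union) (auto intro: disjoint_family_on_mono)
  also have "\<dots> = word_mass p n E"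
    unfolding word_mass_def
    using assms words_digit by (intro sum.cong prob_cylinder) auto
  finally show ?thesis .
qed

definition word_of :: "nat \<Rightarrow> 'a \<Rightarrow> nat \<Rightarrow> nat" where
  "word_of n \<omega> = (\<lambda>k\<in>{1..n}. if \<xi> k \<omega> = 1 then 1 else 0)"

lemma word_of_cylinder:
  assumes "\<forall>k\<ge>1. \<xi> k \<omega> \<in> {0, 1}" "\<omega> \<in> space M"
  shows "word_of n \<omega> \<in> words n" "\<omega> \<in> cylinder n (word_of n \<omega>)"
proof -
  show "word_of n \<omega> \<in> words n"
    by (auto simp: word_of_def words_def)
  have "\<xi> k \<omega> = real (word_of n \<omega> k)" if "k \<in> {1..n}" for k
    using assms(1)[rule_format, of k] that by (auto simp: word_of_def)
  then show "\<omega> \<in> cylinder n (word_of n \<omega>)"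
    using assms(2) by (simp add: cylinder_def)
qed

end

locale random_alternating_series = rapid_denominators q + bernoulli_model M p \<xi>
  for q :: "nat \<Rightarrow> nat" and M :: "'a measure" and p :: "nat \<Rightarrow> nat \<Rightarrow> real"
    and \<xi> :: "nat \<Rightarrow> 'a \<Rightarrow> real"
begin

abbreviation series_value :: "'a \<Rightarrow> real" where
  "series_value \<omega> \<equiv> alternating_series q (\<lambda>k. \<xi> k \<omega>)"

lemma series_value_measurable [measurable]: "series_value \<in> borel_measurable M"
  unfolding alternating_series_def
proof (intro borel_measurable_suminf)
  fix k
  have [measurable]: "\<xi> (Suc k) \<in> borel_measurable M" by (rule xi_measurable) simp
  show "(\<lambda>\<omega>. (-1) ^ (Suc k + 1) * \<xi> (Suc k) \<omega> / real (q (Suc k))) \<in> borel_measurable M"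
    by measurable
qed

sublocale distribution: prob_space "series_distribution M q \<xi>"
  unfolding series_distribution_def by (rule prob_space_distr) simp

lemma sets_distribution [simp, measurable_cong]: "sets (series_distribution M q \<xi>) = sets borel"
  and space_distribution [simp]: "space (series_distribution M q \<xi>) = UNIV"
  by (simp_all add: series_distribution_def)

lemma measure_distribution:
  assumes "A \<in> sets borel"
  shows "measure (series_distribution M q \<xi>) A = prob {\<omega>\<in>space M. series_value \<omega> \<in> A}"
proof -
  have "series_value -` A \<inter> space M = {\<omega>\<in>space M. series_value \<omega> \<in> A}"
    by auto
  then show ?thesis
    unfolding series_distribution_def
    by (simp add: measure_distr[OF series_value_measurable assms])
qed

end

definition digit_set :: "(nat \<Rightarrow> nat) \<Rightarrow> nat \<Rightarrow> (nat \<Rightarrow> nat) set \<Rightarrow> real set" where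
  "digit_set q n E = {y. (\<lambda>k\<in>{1..n}. digit q k y) \<in> E}"

lemma digit_word: "(\<lambda>k\<in>{1..n}. digit q k y) \<in> words n"
  by (auto simp: words_def digit_def)

lemma digit_word_eq_iff:
  assumes "x \<in> words n"
  shows "(\<lambda>k\<in>{1..n}. digit q k y) = x \<longleftrightarrow> (\<forall>k\<in>{1..n}. digit q k y = x k)"
proof
  assume "\<forall>k\<in>{1..n}. digit q k y = x k"
  then show "(\<lambda>k\<in>{1..n}. digit q k y) = x"
    using assms digit_word unfolding words_def by (intro PiE_ext) auto
qed auto

lemma digit_set_borel [measurable]:
  assumes "E \<subseteq> words n"
  shows "digit_set q n E \<in> sets borel"
proof -
  have "digit_set q n E = (\<Union>x\<in>E. {y. \<forall>k\<in>{1..n}. digit q k y = x k})"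
  proof (rule set_eqI)
    fix y
    have "y \<in> digit_set q n E \<longleftrightarrow> (\<exists>x\<in>E. (\<lambda>k\<in>{1..n}. digit q k y) = x)"
      by (simp add: digit_set_def)
    also have "\<dots> \<longleftrightarrow> (\<exists>x\<in>E. \<forall>k\<in>{1..n}. digit q k y = x k)"
      using digit_word_eq_iff assms by (intro bex_cong) auto
    finally show "y \<in> digit_set q n E \<longleftrightarrow> y \<in> (\<Union>x\<in>E. {y. \<forall>k\<in>{1..n}. digit q k y = x k})"
      by simp
  qed
  also have "\<dots> \<in> sets borel"
    using finite_subset[OF assms] by (intro sets.finite_UN) auto
  finally show ?thesis .
qed

lemma Compl_digit_set: "- digit_set q n E = digit_set q n (words n - E)"
proof (rule set_eqI)
  fix y
  show "y \<in> - digit_set q n E \<longleftrightarrow> y \<in> digit_set q n (words n - E)"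
    using digit_word[of q y n] by (simp add: digit_set_def)
qed

context random_alternating_series
begin

text \<open>
  Since almost surely the digits of the value are the random digits, events about finitely many
  digits become Borel sets of reals with the same probability.
\<close>

lemma measure_digit_set:
  assumes E: "E \<subseteq> words n"
  shows "measure (series_distribution M q \<xi>) (digit_set q n E) = word_mass p n E"
proof -
  have "measure (series_distribution M q \<xi>) (digit_set q n E) =
          prob {\<omega>\<in>space M. series_value \<omega> \<in> digit_set q n E}"
    by (rule measure_distribution[OF digit_set_borel[OF E]])
  also have "\<dots> = prob (\<Union>x\<in>E. cylinder n x)"
  proof (rule finite_measure_eq_AE)
    show "AE \<omega> in M. \<omega> \<in> {\<omega>\<in>space M. series_value \<omega> \<in> digit_set q n E}
            \<longleftrightarrow> \<omega> \<in> (\<Union>x\<in>E. cylinder n x)"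
      using AE_xi AE_space
    proof eventually_elim
      case (elim \<omega>)
      have d: "real (digit q k (series_value \<omega>)) = \<xi> k \<omega>" if "k \<ge> 1" for k
        using elim that by (intro digit_alternating_series[of "\<lambda>k. \<xi> k \<omega>"]) auto
      have "(\<lambda>k\<in>{1..n}. digit q k (series_value \<omega>)) = x \<longleftrightarrow> \<omega> \<in> cylinder n x"
        if x: "x \<in> E" for x
      proof -
        have "(\<lambda>k\<in>{1..n}. digit q k (series_value \<omega>)) = x
                \<longleftrightarrow> (\<forall>k\<in>{1..n}. digit q k (series_value \<omega>) = x k)"
          using x E digit_word_eq_iff by blast
        also have "\<dots> \<longleftrightarrow> (\<forall>k\<in>{1..n}. \<xi> k \<omega> = real (x k))"
          using d by (intro ball_cong) (auto simp flip: d)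
        also have "\<dots> \<longleftrightarrow> \<omega> \<in> cylinder n x"
          using elim by (simp add: cylinder_def)
        finally show ?thesis .
      qed
      then show ?case using elim by (auto simp: digit_set_def)
    qed
    show "{\<omega>\<in>space M. series_value \<omega> \<in> digit_set q n E} \<in> events"
      using digit_set_borel[OF E] by measurable
    show "(\<Union>x\<in>E. cylinder n x) \<in> events"
      using finite_subset[OF E] by (intro sets.finite_UN) auto
  qed
  also have "\<dots> = word_mass p n E"
    by (rule prob_cylinder_union[OF E])
  finally show ?thesis .
qed

end

section \<open>Compact sets of values\<close>

definition partial_value :: "(nat \<Rightarrow> nat) \<Rightarrow> nat \<Rightarrow> (nat \<Rightarrow> nat) \<Rightarrow> real" where
  "partial_value q n x = (\<Sum>j<n. (-1) ^ (Suc j + 1) * real (x (Suc j)) / real (q (Suc j)))"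

text \<open>
  The radius is the truncation error at level $n$. So these words cover all digit sequences with
  value in $K$, while every sequence that starts with one of them has its value within twice that
  error of $K$. They bound the law of a compact set from above by masses of words, and tend back to
  that law as $n$ grows.
\<close>

definition near_words :: "(nat \<Rightarrow> nat) \<Rightarrow> nat \<Rightarrow> real set \<Rightarrow> (nat \<Rightarrow> nat) set" where
  "near_words q n K = {x\<in>words n. infdist (partial_value q n x) K \<le> 2 * (1/2) ^ n}"

lemma near_words_subset: "near_words q n K \<subseteq> words n"
  by (auto simp: near_words_def)

lemma infdist_sublevel_borel [measurable]: "{y::real. infdist y K \<le> c} \<in> sets borel"
  by (intro borel_closed closed_Collect_le continuous_intros)

context random_alternating_series
begin

lemma dist_partial_value:
  assumes "\<forall>k\<ge>1. \<xi> k \<omega> \<in> {0, 1}" "\<omega> \<in> cylinder n x"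
  shows "dist (series_value \<omega>) (partial_value q n x) \<le> 2 * (1/2) ^ n"
proof -
  have "partial_value q n x = (\<Sum>j<n. (-1) ^ (Suc j + 1) * \<xi> (Suc j) \<omega> / real (q (Suc j)))"
    using assms(2) by (auto simp: partial_value_def cylinder_def intro!: sum.cong)
  moreover have "\<bar>\<xi> k \<omega>\<bar> \<le> 1" if "k \<ge> 1" for k
    using assms(1) that by auto
  ultimately show ?thesis
    using alternating_series_approx[of "\<lambda>k. \<xi> k \<omega>" n] by (simp add: dist_real_def)
qed

lemma near_words_event: "(\<Union>x\<in>near_words q n K. cylinder n x) \<in> events"
  using finite_subset[OF near_words_subset finite_words] by (intro sets.finite_UN) auto

lemma distribution_le_near_words:
  assumes [measurable]: "K \<in> sets borel"
  shows "measure (series_distribution M q \<xi>) K \<le> word_mass p n (near_words q n K)"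
proof -
  have "prob {\<omega>\<in>space M. series_value \<omega> \<in> K} \<le> prob (\<Union>x\<in>near_words q n K. cylinder n x)"
  proof (rule finite_measure_mono_AE[OF _ near_words_event])
    show "AE \<omega> in M. \<omega> \<in> {\<omega>\<in>space M. series_value \<omega> \<in> K}
            \<longrightarrow> \<omega> \<in> (\<Union>x\<in>near_words q n K. cylinder n x)"
      using AE_xi AE_space
    proof eventually_elim
      case (elim \<omega>)
      note w = word_of_cylinder[OF elim, of n]
      have "infdist (partial_value q n (word_of n \<omega>)) K \<le> 2 * (1/2) ^ n" if "series_value \<omega> \<in> K"
        using infdist_le2[OF that] dist_partial_value[OF elim(1) w(2)] by (simp add: dist_commute)
      then show ?case
        using w by (auto simp: near_words_def)
    qed
  qed
  then show ?thesis
    by (simp add: measure_distribution prob_cylinder_union[OF near_words_subset])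
qed

lemma near_words_le_distribution:
  "word_mass p n (near_words q n K)
     \<le> measure (series_distribution M q \<xi>) {y. infdist y K \<le> 4 * (1/2) ^ n}"
proof -
  have "prob (\<Union>x\<in>near_words q n K. cylinder n x)
          \<le> prob {\<omega>\<in>space M. series_value \<omega> \<in> {y. infdist y K \<le> 4 * (1/2) ^ n}}"
  proof (rule finite_measure_mono_AE)
    show "AE \<omega> in M. \<omega> \<in> (\<Union>x\<in>near_words q n K. cylinder n x)
            \<longrightarrow> \<omega> \<in> {\<omega>\<in>space M. series_value \<omega> \<in> {y. infdist y K \<le> 4 * (1/2) ^ n}}"
      using AE_xi AE_space
    proof eventually_elim
      case (elim \<omega>)
      have "infdist (series_value \<omega>) K \<le> 4 * (1/2) ^ n"
        if "x \<in> near_words q n K" "\<omega> \<in> cylinder n x" for x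
        using infdist_triangle[of "series_value \<omega>" K "partial_value q n x"]
          dist_partial_value[OF elim(1) that(2)] that(1) by (simp add: near_words_def)
      then show ?case using elim by auto
    qed
    show "{\<omega>\<in>space M. series_value \<omega> \<in> {y. infdist y K \<le> 4 * (1/2) ^ n}} \<in> events"
      by measurable
  qed
  then show ?thesis
    by (simp add: measure_distribution prob_cylinder_union[OF near_words_subset])
qed

lemma distribution_neighbourhood_LIMSEQ:
  assumes "closed K" "K \<noteq> {}"
  shows "(\<lambda>n. measure (series_distribution M q \<xi>) {y. infdist y K \<le> 4 * (1/2) ^ n})
           \<longlonglongrightarrow> measure (series_distribution M q \<xi>) K"
proof -
  let ?U = "\<lambda>n::nat. {y. infdist y K \<le> 4 * (1/2) ^ n}"
  have "(\<Inter>n. ?U n) = K"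
  proof (intro equalityI subsetI)
    fix y assume "y \<in> (\<Inter>n. ?U n)"
    then have "infdist y K \<le> 4 * (1/2) ^ n" for n by auto
    moreover have "(\<lambda>n. 4 * (1/2) ^ n) \<longlonglongrightarrow> (4 * 0 :: real)"
      by (intro tendsto_intros LIMSEQ_power_zero) simp
    ultimately have "infdist y K \<le> 0"
      by (intro LIMSEQ_le_const[of "\<lambda>n. 4 * (1/2) ^ n"]) auto
    then show "y \<in> K"
      using in_closed_iff_infdist_zero[OF assms] infdist_nonneg[of y K] by simp
  qed auto
  moreover have "decseq ?U"
    by (intro decseq_SucI) (auto intro: order_trans)
  moreover have "range ?U \<subseteq> sets (series_distribution M q \<xi>)"
    using infdist_sublevel_borel by auto
  ultimately show ?thesis
    using distribution.finite_Lim_measure_decseq[of ?U] by simp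
qed

section \<open>Atoms\<close>

lemma measure_point_le:
  "measure (series_distribution M q \<xi>) {y} \<le> (\<Prod>k=1..n. max (p 0 k) (p 1 k))"
proof -
  let ?w = "\<lambda>k\<in>{1..n}. digit q k y"
  have "measure (series_distribution M q \<xi>) {y}
          \<le> measure (series_distribution M q \<xi>) (digit_set q n {?w})"
    using digit_set_borel[of "{?w}" n q] digit_word
    by (intro distribution.finite_measure_mono) (auto simp: digit_set_def)
  also have "\<dots> = (\<Prod>k=1..n. p (?w k) k)"
    using digit_word by (subst measure_digit_set) (auto simp: word_mass_def)
  also have "\<dots> \<le> (\<Prod>k=1..n. max (p 0 k) (p 1 k))"
    using digit_probs_nonneg[OF probs] by (intro prod_mono) (auto simp: digit_def)
  finally show ?thesis .
qed

text \<open>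
  The point is the value of the sequence of the most likely digits.
\<close>

lemma max_product_le_point:
  obtains y where "max_product p \<le> measure (series_distribution M q \<xi>) {y}"
proof
  define x :: "nat \<Rightarrow> nat" where "x k = (if p 0 k \<ge> p 1 k then 0 else 1)" for k
  let ?y = "alternating_series q (\<lambda>k. real (x k))"
  have "prob (cylinder n x) = (\<Prod>k=1..n. max (p 0 k) (p 1 k))" for n
    by (subst prob_cylinder) (auto simp: x_def max_def intro!: prod.cong)
  then have "(\<lambda>n. prob (cylinder n x)) \<longlonglongrightarrow> max_product p"
    using max_product_LIMSEQ[OF probs] by simp
  moreover have "(\<lambda>n. prob (cylinder n x)) \<longlonglongrightarrow> prob (\<Inter>n. cylinder n x)"
  proof (intro finite_Lim_measure_decseq)
    show "decseq (\<lambda>n. cylinder n x)"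
      by (auto simp: decseq_def cylinder_def)
  qed auto
  ultimately have "max_product p = prob (\<Inter>n. cylinder n x)"
    by (rule LIMSEQ_unique)
  also have "\<dots> \<le> prob {\<omega>\<in>space M. series_value \<omega> \<in> {?y}}"
  proof (rule finite_measure_mono)
    show "(\<Inter>n. cylinder n x) \<subseteq> {\<omega>\<in>space M. series_value \<omega> \<in> {?y}}"
    proof
      fix \<omega> assume w: "\<omega> \<in> (\<Inter>n. cylinder n x)"
      have "\<xi> (Suc k) \<omega> = real (x (Suc k))" for k
      proof -
        have "\<omega> \<in> cylinder (Suc k) x" using w by blast
        then show ?thesis by (simp add: cylinder_def)
      qed
      moreover have "\<omega> \<in> space M"
        using w by (auto simp: cylinder_def)
      ultimately show "\<omega> \<in> {\<omega>\<in>space M. series_value \<omega> \<in> {?y}}"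
        by (simp add: alternating_series_def)
    qed
  qed measurable
  finally show "max_product p \<le> measure (series_distribution M q \<xi>) {?y}"
    by (simp add: measure_distribution)
qed

lemma no_atoms_iff:
  "(\<forall>y. emeasure (series_distribution M q \<xi>) {y} = 0) \<longleftrightarrow> max_product p = 0"
proof
  assume "\<forall>y. emeasure (series_distribution M q \<xi>) {y} = 0"
  then have "measure (series_distribution M q \<xi>) {y} = 0" for y
    by (simp add: measure_def)
  then have "max_product p \<le> 0"
    using max_product_le_point by metis
  moreover have "0 \<le> max_product p"
  proof (rule LIMSEQ_le_const[OF max_product_LIMSEQ[OF probs]])
    have "0 \<le> (\<Prod>k=1..n. max (p 0 k) (p 1 k))" for n
      using digit_probs_nonneg[OF probs] by (intro prod_nonneg) (auto simp: le_max_iff_disj)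
    then show "\<exists>N. \<forall>n\<ge>N. 0 \<le> (\<Prod>k=1..n. max (p 0 k) (p 1 k))" by blast
  qed
  ultimately show "max_product p = 0" by simp
next
  assume D: "max_product p = 0"
  have "measure (series_distribution M q \<xi>) {y} \<le> 0" for y
    using LIMSEQ_le_const[OF max_product_LIMSEQ[OF probs]] measure_point_le D by metis
  then show "\<forall>y. emeasure (series_distribution M q \<xi>) {y} = 0"
    by (simp add: distribution.emeasure_eq_measure measure_le_0_iff)
qed

end

section \<open>The dichotomy\<close>

text \<open>
  The upper limit of the sets $A_j$ is null for the first measure by Borel-Cantelli. A point outside
  it lies in all but finitely many complements, hence in the upper limit of the complements, which
  is null for the second measure.
\<close>

lemma mutually_singular_if_separated:
  assumes "finite_measure M" "finite_measure N" and sets: "sets M = sets N"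
    and sep: "\<And>j::nat. \<exists>A\<in>sets M. measure M A \<le> (1/2) ^ j \<and> measure N (space N - A) \<le> (1/2) ^ j"
  shows "mutually_singular M N"
proof -
  interpret M: finite_measure M by fact
  interpret N: finite_measure N by fact
  obtain A where A: "\<And>j. A j \<in> sets M" "\<And>j. measure M (A j) \<le> (1/2) ^ j"
      "\<And>j. measure N (space N - A j) \<le> (1/2) ^ j"
    using sep by metis
  have summ: "summable f" if "\<And>j. 0 \<le> f j" "\<And>j. f j \<le> (1/2) ^ j" for f :: "nat \<Rightarrow> real"
    using that by (intro summable_comparison_test'[OF summable_geometric[of "1/2"], of 0]) auto
  have 1: "limsup A \<in> null_sets M"
    using A by (intro borel_cantelli_limsup1 summ) (auto simp: M.emeasure_eq_measure)
  have 2: "limsup (\<lambda>j. space N - A j) \<in> null_sets N"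
    using A sets by (intro borel_cantelli_limsup1 summ) (auto simp: N.emeasure_eq_measure)
  have "space N - limsup A \<subseteq> limsup (\<lambda>j. space N - A j)"
  proof
    fix x assume x: "x \<in> space N - limsup A"
    then obtain m where m: "\<And>i. i \<ge> m \<Longrightarrow> x \<notin> A i"
      unfolding limsup_INF_SUP by auto
    have "\<exists>i\<in>{n..}. x \<in> space N - A i" for n
      using m[of "max m n"] x by (intro bexI[of _ "max m n"]) auto
    then show "x \<in> limsup (\<lambda>j. space N - A j)"
      unfolding limsup_INF_SUP by blast
  qed
  moreover have "space N - limsup A \<in> sets N"
    using 1 sets by (auto dest: null_setsD2)
  ultimately have "space N - limsup A \<in> null_sets N"
    using null_sets_subset[OF 2] by blast
  then have "limsup A \<in> sets M \<and> emeasure M (limsup A) = 0 \<and>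
      emeasure N (space N - limsup A) = 0"
    using 1 by (simp add: null_sets_def)
  then show ?thesis
    unfolding mutually_singular_def using sets by blast
qed

locale uniform_comparison =
  P: random_alternating_series q M p \<xi> + Q: random_alternating_series q N ps \<xi>s
  for q :: "nat \<Rightarrow> nat"
    and M :: "'a measure" and p :: "nat \<Rightarrow> nat \<Rightarrow> real" and \<xi> :: "nat \<Rightarrow> 'a \<Rightarrow> real"
    and N :: "'b measure" and ps :: "nat \<Rightarrow> nat \<Rightarrow> real" and \<xi>s :: "nat \<Rightarrow> 'b \<Rightarrow> real" +
  assumes uniform: "uniform_probs p ps"
begin

abbreviation \<mu> :: "real measure" where "\<mu> \<equiv> series_distribution M q \<xi>"
abbreviation \<nu> :: "real measure" where "\<nu> \<equiv> series_distribution N q \<xi>s"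

lemma measure_closed_bound:
  assumes summ: "summable (bias p)" and K: "closed K"
  shows "(measure \<mu> K)\<^sup>2 \<le> exp (suminf (bias p)) * measure \<nu> K"
proof (cases "K = {}")
  \<comment> \<open>the distance to the empty set is 0 by convention, so the empty set is a case of its own\<close>
  case False
  have "(measure \<mu> K)\<^sup>2 \<le> exp (suminf (bias p)) * measure \<nu> {y. infdist y K \<le> 4 * (1/2) ^ n}" for n
  proof -
    have "(measure \<mu> K)\<^sup>2 \<le> (word_mass p n (near_words q n K))\<^sup>2"
      using P.distribution_le_near_words[of K n] K by (intro power_mono) auto
    also have "\<dots> \<le> exp (\<Sum>k=1..n. bias p k) * word_mass ps n (near_words q n K)"
      by (rule word_mass_chi_square[OF P.probs uniform near_words_subset])
    also have "\<dots> \<le> exp (suminf (bias p)) * measure \<nu> {y. infdist y K \<le> 4 * (1/2) ^ n}"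
    proof (intro mult_mono)
      show "exp (\<Sum>k=1..n. bias p k) \<le> exp (suminf (bias p))"
        using summ by (simp add: sum_le_suminf bias_nonneg)
      show "0 \<le> word_mass ps n (near_words q n K)"
        by (rule word_mass_nonneg[OF Q.probs near_words_subset])
    qed (simp_all add: Q.near_words_le_distribution)
    finally show ?thesis .
  qed
  then show ?thesis
    using Q.distribution_neighbourhood_LIMSEQ[OF K False]
    by (intro LIMSEQ_le_const[OF tendsto_mult_left]) auto
qed simp

text \<open>
  The compact subsets of a $\nu$-null set are $\nu$-null, hence $\mu$-null by the bound for closed
  sets, and they exhaust the $\mu$-mass of the set.
\<close>

lemma absolutely_continuous_if_summable:
  assumes "summable (bias p)"
  shows "absolutely_continuous \<nu> \<mu>"
  unfolding absolutely_continuous_def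
proof
  fix A assume A: "A \<in> null_sets \<nu>"
  have "emeasure \<mu> K = 0" if "K \<subseteq> A" "compact K" for K
  proof -
    have "K \<in> sets \<nu>" using that by (simp add: borel_closed compact_imp_closed)
    then have "measure \<nu> K = 0"
      using A that emeasure_mono[of K A \<nu>] by (auto simp: null_sets_def measure_def)
    then have "measure \<mu> K = 0"
      using measure_closed_bound[OF assms compact_imp_closed[OF that(2)]] by simp
    then show ?thesis by (simp add: P.distribution.emeasure_eq_measure)
  qed
  then have "(SUP K \<in> {K. K \<subseteq> A \<and> compact K}. emeasure \<mu> K) = 0"
    by (auto intro!: antisym SUP_least)
  moreover have "emeasure \<mu> A = (SUP K \<in> {K. K \<subseteq> A \<and> compact K}. emeasure \<mu> K)"
    using A by (intro inner_regular) auto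
  ultimately show "A \<in> null_sets \<mu>"
    using A by (auto simp: null_sets_def)
qed

lemma mutually_singular_if_not_summable:
  assumes "\<not> summable (bias p)"
  shows "mutually_singular \<mu> \<nu>"
proof (rule mutually_singular_if_separated)
  fix j :: nat
  \<comment> \<open>beyond this level the Hellinger bound falls below $e^{-j} \le 2^{-j}$\<close>
  have "\<exists>n. 8 * real j < (\<Sum>k\<le>n. bias p k)"
    using bounded_imp_summable[of "bias p" "8 * real j", OF bias_nonneg] assms by (meson not_le)
  then obtain n where n: "8 * real j < (\<Sum>k\<le>n. bias p k)" ..
  have "(\<Sum>k\<le>n. bias p k) = (\<Sum>k=1..n. bias p k)"
    by (rule sum.mono_neutral_right) (auto simp: bias_def)
  then have "exp (- (\<Sum>k=1..n. bias p k) / 8) \<le> exp (- real j)"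
    using n by simp
  also have "\<dots> = exp (-1) ^ j"
    by (simp add: exp_of_nat_mult[symmetric])
  also have "\<dots> \<le> (1/2) ^ j"
  proof (rule power_mono)
    have "(2::real) \<le> exp 1" using exp_ge_add_one_self[of 1] by simp
    then show "exp (-1) \<le> (1/2 :: real)" by (simp add: exp_minus field_simps)
  qed simp
  finally have small: "exp (- (\<Sum>k=1..n. bias p k) / 8) \<le> (1/2) ^ j" .
  obtain E where E: "E \<subseteq> words n"
      "word_mass ps n E \<le> exp (- (\<Sum>k=1..n. bias p k) / 8)"
      "word_mass p n (words n - E) \<le> exp (- (\<Sum>k=1..n. bias p k) / 8)"
    using word_mass_separation[OF P.probs uniform] by blast
  let ?A = "digit_set q n (words n - E)"
  have "space \<nu> - ?A = digit_set q n E"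
    using E(1) by (simp add: Compl_digit_set[symmetric] double_diff flip: Compl_eq_Diff_UNIV)
  then have "measure \<mu> ?A \<le> (1/2) ^ j" "measure \<nu> (space \<nu> - ?A) \<le> (1/2) ^ j"
    using E small P.measure_digit_set[of "words n - E" n] Q.measure_digit_set[of E n] by simp_all
  moreover have "?A \<in> sets \<mu>"
    using digit_set_borel[of "words n - E" n q] by simp
  ultimately show "\<exists>A\<in>sets \<mu>. measure \<mu> A \<le> (1/2) ^ j \<and> measure \<nu> (space \<nu> - A) \<le> (1/2) ^ j"
    by blast
qed (simp_all add: P.distribution.finite_measure_axioms Q.distribution.finite_measure_axioms)

lemma not_singular_if_absolutely_continuous:
  assumes "absolutely_continuous \<nu> \<mu>"
  shows "\<not> mutually_singular \<mu> \<nu>"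
proof
  assume "mutually_singular \<mu> \<nu>"
  then obtain A where A: "A \<in> sets \<mu>" "emeasure \<mu> A = 0" "emeasure \<nu> (space \<nu> - A) = 0"
    unfolding mutually_singular_def by blast
  have "UNIV - A \<in> sets \<nu>"
    using A(1) by simp
  then have "emeasure \<mu> (UNIV - A) = 0"
    using absolutely_continuousD[OF assms, of "UNIV - A"] A(3) by simp
  moreover have "measure \<mu> (UNIV - A) = 1 - measure \<mu> A"
    using P.distribution.prob_compl[OF A(1)] by simp
  ultimately show False
    using A(2) by (simp add: measure_def)
qed

end

lemma summable_bias_iff:
  "summable (bias p) \<longleftrightarrow>
     (\<lambda>k. (1 - 2 * p 0 k)\<^sup>2) summable_on {k. k \<ge> 1 \<and> p 0 k * p 1 k > 0}"
proof -
  have "summable (bias p) \<longleftrightarrow> bias p summable_on UNIV"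
    by (rule summable_on_UNIV_nonneg_real_iff[OF bias_nonneg, symmetric])
  also have "\<dots> \<longleftrightarrow> (\<lambda>k. (1 - 2 * p 0 k)\<^sup>2) summable_on {k. k \<ge> 1 \<and> p 0 k * p 1 k > 0}"
    by (rule summable_on_cong_neutral) (auto simp: bias_def)
  finally show ?thesis .
qed

theorem theorem6:
  fixes q :: "nat \<Rightarrow> nat"
    and p ps :: "nat \<Rightarrow> nat \<Rightarrow> real"
    and M :: "'a measure" and \<xi> :: "nat \<Rightarrow> 'a \<Rightarrow> real"
    and N :: "'b measure" and \<xi>s :: "nat \<Rightarrow> 'b \<Rightarrow> real"
    and \<mu> \<nu>s :: "real measure"
  assumes q_pos: "\<forall>k\<ge>1. 0 < q k"
    and q_growth: "\<forall>k\<ge>1. q (k + 1) \<ge> q k * (q k + 1)"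
    and p: "digit_probs p"
    and \<xi>: "bernoulli_digits M p \<xi>"
    and \<mu>: "\<mu> = series_distribution M q \<xi>"
    and ps: "uniform_probs p ps"
    and \<xi>s: "bernoulli_digits N ps \<xi>s"
    and \<nu>s: "\<nu>s = series_distribution N q \<xi>s"
  shows "(absolutely_continuous \<nu>s \<mu> \<longleftrightarrow>
            (\<lambda>k. (1 - 2 * p 0 k)\<^sup>2) summable_on {k. k \<ge> 1 \<and> p 0 k * p 1 k > 0}) \<and>
         (singularly_continuous_wrt \<mu> \<nu>s \<longleftrightarrow>
            max_product p = 0 \<and>
            \<not> (\<lambda>k. (1 - 2 * p 0 k)\<^sup>2) summable_on {k. k \<ge> 1 \<and> p 0 k * p 1 k > 0})"
proof -
  interpret U: uniform_comparison q M p \<xi> N ps \<xi>s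
    using assms uniform_probs_digit_probs[OF p ps] by unfold_locales auto
  have ac: "absolutely_continuous \<nu>s \<mu> \<longleftrightarrow> summable (bias p)"
    and sing: "mutually_singular \<mu> \<nu>s \<longleftrightarrow> \<not> summable (bias p)"
    unfolding \<mu> \<nu>s
    using U.absolutely_continuous_if_summable U.mutually_singular_if_not_summable
      U.not_singular_if_absolutely_continuous by blast+
  show ?thesis
    using ac sing U.P.no_atoms_iff unfolding singularly_continuous_wrt_def summable_bias_iff \<mu>
    by blast
qed

end
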